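(* Suppose the plant $P(s)=\dfrac{s-z_1}{s-p_1}$ has one real positive zero $z_1$ and one real positive pole $p_1$, where $z_1>p_1>0$, and let $\hat w(s)=1/s$ (i.e. $w\equiv1$ on $[0,\infty)$). Define $h:=p_1/(z_1-p_1)$. Then (i) $\mathrm{OS}_{\mathrm{opt}}:=\inf_{e\in\mathcal{F}}\sup_{t}(-e(t))_+=h$; (ii) $\mathrm{MA}_{\mathrm{opt}}:=\inf_{e\in\mathcal{F}}\sup_t|e(t)|=\dfrac{1}{1-2^{-1/h}}$; (iii) $\mathrm{FL}_{\mathrm{opt}}:=\inf_{e\in\mathcal{F}}\tfrac12\big[\sup_te(t)-\inf_te(t)\big]=\dfrac{(h+1)^{h+1}}{2h^h}$; (iv) $\mathrm{POS}_{\mathrm{opt}}:=\inf_{e\in\mathcal{F}}\sup_t(e(t))_+=1$.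
   Context: $\mathbb{R}_+=[0,\infty)$; $\hat g$ denotes the Laplace transform of $g$; $\lambda_+=\max(\lambda,0)$; suprema and infima over $t$ are over $t\in\mathbb{R}_+$. $C_0(\mathbb{R}_+)$ is the space of continuous $\varphi:\mathbb{R}_+\to\mathbb{R}$ with $\lim_{t\to\infty}\varphi(t)=0$. $\mathcal{S}$ is the set of proper real-rational functions with no poles in the closed right half-plane. Let $P=\hat n/\hat d$ be a coprime factorization with $\hat n,\hat d\in\mathcal{S}$, and let $\hat x,\hat v\in\mathcal{S}$ satisfy $\hat x\hat n+\hat v\hat d=1$. $\mathcal{F}$ is the set of closed-loop error signals tending to zero that are achievable by rational stabilising controllers for $P$ with reference input $w$: $\mathcal{F}=\{e\in C_0(\mathbb{R}_+)\mid \hat e=\hat w\hat d(\hat v-\hat q\hat n)\text{ for some }\hat q\in\mathcal{S}\}$. *)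

theory Defs
  imports "HOL-Analysis.Analysis" "HOL-Computational_Algebra.Polynomial_Factorial"
    "HOL-Computational_Algebra.Normalized_Fraction" "HOL-Computational_Algebra.Field_as_Ring"
begin

section \<open>Real-rational transfer functions\<close>

text \<open>
  A real-rational function is an element of the field of fractions of the real polynomial
  ring.  Numerator and denominator are those of its normalised (in particular reduced) fraction, so
  that the zeros of the denominator are exactly the poles.
\<close>

type_synonym ratfun = "real poly fract"

definition rnum :: "ratfun \<Rightarrow> real poly" where
  "rnum r = fst (quot_of_fract r)"

definition rden :: "ratfun \<Rightarrow> real poly" where
  "rden r = snd (quot_of_fract r)"

text \<open>At a pole the value is the junk value 0.\<close>

definition reval :: "ratfun \<Rightarrow> complex \<Rightarrow> complex" where
  "reval r s = poly (map_poly complex_of_real (rnum r)) s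
             / poly (map_poly complex_of_real (rden r)) s"

definition rpoles :: "ratfun \<Rightarrow> complex set" where
  "rpoles r = {s. poly (map_poly complex_of_real (rden r)) s = 0}"

definition proper_rat :: "ratfun \<Rightarrow> bool" where
  "proper_rat r \<longleftrightarrow> degree (rnum r) \<le> degree (rden r)"

definition stable_rat :: "ratfun set" where
  "stable_rat = {r. proper_rat r \<and> (\<forall>s\<in>rpoles r. Re s < 0)}"

section \<open>Signals on the half-line\<close>

text \<open>
  Signals are total functions on the reals of which only the restriction to \<open>{0..}\<close> matters.
\<close>

definition C0_half_line :: "(real \<Rightarrow> real) set" where
  "C0_half_line = {f. continuous_on {0..} f \<and> (f \<longlongrightarrow> 0) at_top}"

definition laplace :: "(real \<Rightarrow> real) \<Rightarrow> complex \<Rightarrow> complex" where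
  "laplace f s = (LINT t:{0..}|lborel. exp (- (s * of_real t)) * of_real (f t))"

text \<open>
  Bounded continuous signals have absolutely convergent Laplace transforms on the open right
  half-plane; for such a reference \<open>w\<close> this is where the transforms of the error and of \<open>w\<close>
  are compared.
\<close>

definition closed_loop_errors ::
  "(real \<Rightarrow> real) \<Rightarrow> ratfun \<Rightarrow> ratfun \<Rightarrow> ratfun \<Rightarrow> (real \<Rightarrow> real) set" where
  "closed_loop_errors w n d v =
     {e \<in> C0_half_line. \<exists>q\<in>stable_rat. \<forall>s. Re s > 0 \<longrightarrow>
        laplace e s = laplace w s * reval (d * (v - q * n)) s}"

section \<open>Optimal performance indices\<close>

text \<open>
  Infima and suprema are taken in the extended reals, so that the infimum over an empty set of
  errors would be \<open>\<infinity>\<close> instead of an unspecified real number.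
\<close>

definition OS_opt :: "(real \<Rightarrow> real) set \<Rightarrow> ereal" where
  "OS_opt F = (INF e\<in>F. SUP t\<in>{0..}. ereal (max (- e t) 0))"

definition MA_opt :: "(real \<Rightarrow> real) set \<Rightarrow> ereal" where
  "MA_opt F = (INF e\<in>F. SUP t\<in>{0..}. ereal \<bar>e t\<bar>)"

definition FL_opt :: "(real \<Rightarrow> real) set \<Rightarrow> ereal" where
  "FL_opt F = (INF e\<in>F. ereal (1 / 2) *
     ((SUP t\<in>{0..}. ereal (e t)) - (INF t\<in>{0..}. ereal (e t))))"

definition POS_opt :: "(real \<Rightarrow> real) set \<Rightarrow> ereal" where
  "POS_opt F = (INF e\<in>F. SUP t\<in>{0..}. ereal (max (e t) 0))"

end

theory Submission
  imports Defs "HOL-Real_Asymp.Real_Asymp"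
begin

text \<open>
  The idea is that closed-loop stability only constrains the error at the unstable pole and at the
  nonminimum-phase zero of the plant.  Every admissible error \<open>e\<close> satisfies the two
  interpolation conditions
  \<open>\<integral> e(t) exp (-p1 t) dt = 0\<close> and \<open>\<integral> e(t) exp (-z1 t) dt = 1 / z1\<close>
  (\<open>error_interpolation\<close>), and conversely every polynomial in \<open>exp (-t)\<close> without constant term
  that satisfies them is admissible (\<open>poly_exp_closed_loop_error\<close>).  All four indices are thus
  optima of linear programs over signals bounded by \<open>-m \<le> e \<le> M\<close> with two linear
  constraints.

  The dual multipliers form the test function
  \<open>exp (-z1 t) - \<lambda> exp (-p1 t)\<close>, which changes sign exactly once, from plus to minus, at a
  time \<open>T\<close> that fixes \<open>\<lambda>\<close>.  Its integral against \<open>e\<close> is therefore largest for the bang-bang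
  signal that equals \<open>M\<close> before \<open>T\<close> and \<open>-m\<close> afterwards, and this gives one inequality between
  \<open>M\<close> and \<open>m\<close> for each \<open>T\<close> (\<open>bang_bang_bound\<close>).  On the other side, for each \<open>T > 0\<close> exactly one
  choice of \<open>M\<close> and \<open>m\<close> makes the bang-bang signal satisfy the interpolation conditions,
  namely \<open>M = overshoot T\<close> and \<open>m = undershoot T\<close>.  That signal is discontinuous and does not
  vanish at infinity, but it is an almost everywhere limit of uniformly bounded polynomials in \<open>exp (-t)\<close>,
  so its bounds are met up to any \<open>\<epsilon>\<close> (\<open>near_bang_bang_error\<close>).

  The four values come from four choices of the switching time.  The undershoot is optimal in the
  limit \<open>T \<rightarrow> 0\<close>, a short high peak followed by a long plateau; the positive overshoot in the
  limit \<open>T \<rightarrow> \<infinity>\<close>, where the error follows the reference for a long time; the maximal amplitude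
  when the two levels have equal size, at \<open>T = ln 2 / p1\<close>; and the fluctuation when the sum of the two
  levels is least, at \<open>T = ln (z1 / p1) / (z1 - p1)\<close>, where the test function integrates to zero
  and so does not see the mean of the two levels.
\<close>

section \<open>Evaluation and stability of rational functions\<close>

abbreviation ceval :: "real poly \<Rightarrow> complex \<Rightarrow> complex" where
  "ceval p \<equiv> poly (map_poly complex_of_real p)"

lemma ceval_add: "ceval (p + q) s = ceval p s + ceval q s"
proof -
  have "map_poly complex_of_real (p + q) = map_poly of_real p + map_poly of_real q"
    by (rule poly_eqI) (simp add: coeff_map_poly)
  thus ?thesis by simp
qed

lemma ceval_smult: "ceval (smult a p) s = of_real a * ceval p s"
proof -
  have "map_poly complex_of_real (smult a p) = smult (of_real a) (map_poly of_real p)"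
    by (rule poly_eqI) (simp add: coeff_map_poly)
  thus ?thesis by simp
qed

lemma ceval_pCons: "ceval (pCons a p) s = of_real a + s * ceval p s"
  by (simp add: map_poly_pCons)

lemma ceval_mult: "ceval (p * q) s = ceval p s * ceval q s"
  by (induction p) (simp_all add: ceval_add ceval_smult ceval_pCons algebra_simps)

lemma ceval_of_real: "ceval p (of_real c) = of_real (poly p c)"
  by (induction p) (simp_all add: ceval_pCons)

lemma rden_nonzero: "rden r \<noteq> 0"
  by (simp add: rden_def)

lemma Fract_rnum_rden: "Fract (rnum r) (rden r) = r"
  by (simp add: rnum_def rden_def)

lemma rnum_rden_bezout: "\<exists>a b. a * rnum r + b * rden r = 1"
proof -
  have "coprime (rnum r) (rden r)"
    by (simp add: rnum_def rden_def coprime_quot_of_fract)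
  hence "fst (bezout_coefficients (rnum r) (rden r)) * rnum r
       + snd (bezout_coefficients (rnum r) (rden r)) * rden r = 1"
    using bezout_coefficients_fst_snd[of "rnum r" "rden r"] by simp
  thus ?thesis by blast
qed

lemma Fract_cross:
  assumes "b \<noteq> 0"
  shows "a * rden (Fract a b) = rnum (Fract a b) * b"
  using assms Fract_rnum_rden[of "Fract a b"] rden_nonzero[of "Fract a b"]
  by (metis eq_fract(1) )

text \<open>
  Reduced numerator and denominator have no common complex root, because a real Bezout identity
  remains valid at complex points.  Hence poles and values can be read off any representation
  whose denominator does not vanish, and the reduced form never has to be computed.
\<close>
lemma rden_Fract_nonzero:
  assumes "ceval b s \<noteq> 0"
  shows "ceval (rden (Fract a b)) s \<noteq> 0"
proof
  let ?n = "rnum (Fract a b)" and ?d = "rden (Fract a b)"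
  assume 0: "ceval ?d s = 0"
  have "b \<noteq> 0" using assms by auto
  hence "ceval a s * ceval ?d s = ceval ?n s * ceval b s"
    using Fract_cross[of b a] by (metis ceval_mult)
  with 0 assms have "ceval ?n s = 0" by simp
  moreover obtain u v where "u * ?n + v * ?d = 1" using rnum_rden_bezout by blast
  hence "ceval u s * ceval ?n s + ceval v s * ceval ?d s = 1"
    by (metis ceval_add ceval_mult map_poly_1' of_real_1 poly_1)
  ultimately show False using 0 by simp
qed

lemma reval_Fract:
  assumes "ceval b s \<noteq> 0"
  shows "reval (Fract a b) s = ceval a s / ceval b s"
proof -
  have "b \<noteq> 0" using assms by auto
  hence "ceval a s * ceval (rden (Fract a b)) s = ceval (rnum (Fract a b)) s * ceval b s"
    using Fract_cross[of b a] by (metis ceval_mult)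
  thus ?thesis using assms rden_Fract_nonzero[OF assms]
    by (simp add: reval_def field_simps)
qed

lemma Fract_stable:
  assumes "b \<noteq> 0" "degree a \<le> degree b" "\<And>s. Re s \<ge> 0 \<Longrightarrow> ceval b s \<noteq> 0"
  shows "Fract a b \<in> stable_rat"
proof -
  let ?n = "rnum (Fract a b)" and ?d = "rden (Fract a b)"
  have "degree ?n \<le> degree ?d"
  proof (cases "?n = 0")
    case False
    have eq: "a * ?d = ?n * b" using Fract_cross assms by blast
    moreover have "a \<noteq> 0" using eq False assms(1) by auto
    ultimately have "degree a + degree ?d = degree ?n + degree b"
      using False assms(1) rden_nonzero by (metis degree_mult_eq)
    with assms(2) show ?thesis by simp
  qed simp
  moreover have "Re s < 0" if "s \<in> rpoles (Fract a b)" for s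
    using that assms(3)[of s] rden_Fract_nonzero[of b s a]
    by (force simp: rpoles_def not_less[symmetric])
  ultimately show ?thesis by (simp add: stable_rat_def proper_rat_def)
qed

lemma stableE:
  assumes "r \<in> stable_rat"
  obtains a b where "r = Fract a b" "b \<noteq> 0" "degree a \<le> degree b"
    "\<And>s. Re s \<ge> 0 \<Longrightarrow> ceval b s \<noteq> 0"
proof
  show "r = Fract (rnum r) (rden r)" by (simp add: Fract_rnum_rden)
  show "rden r \<noteq> 0" by (rule rden_nonzero)
qed (use assms in \<open>auto simp: stable_rat_def proper_rat_def rpoles_def\<close>)

lemma stable_mult:
  assumes "r \<in> stable_rat" "r' \<in> stable_rat"
  shows stable_mult_closed: "r * r' \<in> stable_rat"
    and reval_mult: "Re s \<ge> 0 \<Longrightarrow> reval (r * r') s = reval r s * reval r' s"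
proof -
  obtain a b where r: "r = Fract a b" "b \<noteq> 0" "degree a \<le> degree b"
    "\<And>s. Re s \<ge> 0 \<Longrightarrow> ceval b s \<noteq> 0" using stableE[OF assms(1)] by blast
  obtain c e where r': "r' = Fract c e" "e \<noteq> 0" "degree c \<le> degree e"
    "\<And>s. Re s \<ge> 0 \<Longrightarrow> ceval e s \<noteq> 0" using stableE[OF assms(2)] by blast
  have "degree (a * c) \<le> degree a + degree c" by (rule degree_mult_le)
  also have "\<dots> \<le> degree (b * e)" using r r' by (simp add: degree_mult_eq)
  finally have "degree (a * c) \<le> degree (b * e)" .
  with r r' show "r * r' \<in> stable_rat" by (auto intro!: Fract_stable simp: ceval_mult)
  show "reval (r * r') s = reval r s * reval r' s" if "Re s \<ge> 0"
    using r r' that by (simp add: reval_Fract ceval_mult)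
qed

lemma stable_add:
  assumes "r \<in> stable_rat" "r' \<in> stable_rat"
  shows stable_add_closed: "r + r' \<in> stable_rat"
    and reval_add: "Re s \<ge> 0 \<Longrightarrow> reval (r + r') s = reval r s + reval r' s"
proof -
  obtain a b where r: "r = Fract a b" "b \<noteq> 0" "degree a \<le> degree b"
    "\<And>s. Re s \<ge> 0 \<Longrightarrow> ceval b s \<noteq> 0" using stableE[OF assms(1)] by blast
  obtain c e where r': "r' = Fract c e" "e \<noteq> 0" "degree c \<le> degree e"
    "\<And>s. Re s \<ge> 0 \<Longrightarrow> ceval e s \<noteq> 0" using stableE[OF assms(2)] by blast
  have deg: "degree (b * e) = degree b + degree e" using r(2) r'(2) by (rule degree_mult_eq)
  have "degree (a * e) \<le> degree (b * e)"
    using degree_mult_le[of a e] r(3) deg by linarith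
  moreover have "degree (c * b) \<le> degree (b * e)"
    using degree_mult_le[of c b] r'(3) deg by linarith
  ultimately have "degree (a * e + c * b) \<le> degree (b * e)" by (rule degree_add_le)
  with r r' show "r + r' \<in> stable_rat" by (auto intro!: Fract_stable simp: ceval_mult)
  show "reval (r + r') s = reval r s + reval r' s" if "Re s \<ge> 0"
    using r(4)[OF that] r'(4)[OF that]
    by (simp add: r(1,2) r'(1,2) reval_Fract ceval_mult ceval_add add_frac_eq)
qed

lemma stable_const: "Fract [:c:] 1 \<in> stable_rat"
  by (rule Fract_stable) auto

lemma reval_1: "reval 1 s = 1"
  using reval_Fract[of 1 s 1] by (simp add: One_fract_def)

lemma stable_uminus:
  assumes "r \<in> stable_rat"
  shows stable_uminus_closed: "- r \<in> stable_rat"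
    and reval_uminus: "Re s \<ge> 0 \<Longrightarrow> reval (- r) s = - reval r s"
proof -
  have eq: "- r = Fract [:-1:] 1 * r"
    by (cases r) auto
  show "- r \<in> stable_rat" unfolding eq by (intro stable_mult_closed stable_const assms)
  show "reval (- r) s = - reval r s" if "Re s \<ge> 0"
    unfolding eq using that by (simp add: reval_mult[OF stable_const assms] reval_Fract ceval_pCons)
qed

lemma stable_diff:
  assumes "r \<in> stable_rat" "r' \<in> stable_rat"
  shows stable_diff_closed: "r - r' \<in> stable_rat"
    and reval_diff: "Re s \<ge> 0 \<Longrightarrow> reval (r - r') s = reval r s - reval r' s"
  using stable_add[OF assms(1) stable_uminus_closed[OF assms(2)]] reval_uminus[OF assms(2)]
  by auto

lemma stable_0: "0 \<in> stable_rat" and reval_0: "reval 0 s = 0"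
  using stable_const[of 0] reval_Fract[of 1 s 0] by (simp_all add: Zero_fract_def)

lemma stable_sum:
  assumes "finite A" "\<And>k. k \<in> A \<Longrightarrow> r k \<in> stable_rat"
  shows stable_sum_closed: "sum r A \<in> stable_rat"
    and reval_sum: "Re s \<ge> 0 \<Longrightarrow> reval (sum r A) s = (\<Sum>k\<in>A. reval (r k) s)"
proof -
  have "sum r A \<in> stable_rat \<and> (Re s \<ge> 0 \<longrightarrow> reval (sum r A) s = (\<Sum>k\<in>A. reval (r k) s))"
    using assms by (induction A) (auto simp: stable_0 reval_0 stable_add_closed reval_add)
  thus "sum r A \<in> stable_rat" "Re s \<ge> 0 \<Longrightarrow> reval (sum r A) s = (\<Sum>k\<in>A. reval (r k) s)"
    by auto
qed

text \<open>
  The function \<open>(s - c) / (s + 1)\<close>: a stable function of relative degree zero whose only zero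
  is \<open>c\<close>.
\<close>
definition real_zero_factor :: "real \<Rightarrow> ratfun" where
  "real_zero_factor c = Fract [:- c, 1:] [:1, 1:]"

lemma ceval_1_plus_s: "Re s \<ge> 0 \<Longrightarrow> ceval [:1, 1:] s \<noteq> 0"
  by (auto simp: ceval_pCons complex_eq_iff)

lemma real_zero_factor_stable: "real_zero_factor c \<in> stable_rat"
  unfolding real_zero_factor_def using ceval_1_plus_s by (intro Fract_stable) auto

lemma reval_real_zero_factor:
  assumes "Re s \<ge> 0"
  shows "reval (real_zero_factor c) s = (s - of_real c) / (1 + s)"
  using ceval_1_plus_s[OF assms]
  by (simp add: real_zero_factor_def reval_Fract ceval_pCons)

text \<open>
  A zero of a stable function in the closed right half-plane can be divided out without leaving
  the ring of stable functions: the factor \<open>s + 1\<close> put in its place keeps the quotient proper.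
\<close>
lemma stable_cancel_zero:
  assumes r: "r \<in> stable_rat" and c: "c \<ge> 0" and zero: "reval r (of_real c) = 0"
  obtains r' where "r' \<in> stable_rat" "r = real_zero_factor c * r'"
proof -
  obtain a b where ab: "r = Fract a b" "b \<noteq> 0" "degree a \<le> degree b"
    "\<And>s. Re s \<ge> 0 \<Longrightarrow> ceval b s \<noteq> 0" using stableE[OF r] by blast
  have "ceval a (of_real c) = 0" using zero ab c by (simp add: reval_Fract)
  hence "poly a c = 0" by (simp add: ceval_of_real)
  then obtain a' where a': "a = [:- c, 1:] * a'" by (auto simp: poly_eq_0_iff_dvd elim: dvdE)
  have "degree ([:1, 1:] * a') = degree a"
    by (cases "a' = 0") (simp_all add: a' degree_mult_eq del: mult_pCons_left)
  hence "Fract ([:1, 1:] * a') b \<in> stable_rat"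
    using ab by (intro Fract_stable) auto
  moreover have "r = real_zero_factor c * Fract ([:1, 1:] * a') b"
    using mult_fract_cancel[of "[:1, 1:]" "[:- c, 1:] * a'" b]
    unfolding ab(1) a' real_zero_factor_def mult_fract
    by (simp only: mult.left_commute[of "[:- c, 1:]"]) simp
  ultimately show ?thesis using that by blast
qed

section \<open>Laplace transforms of polynomials in a decaying exponential\<close>

definition real_laplace :: "(real \<Rightarrow> real) \<Rightarrow> real \<Rightarrow> real" where
  "real_laplace f s = (LINT t:{0..}|lborel. exp (- (s * t)) * f t)"

lemma laplace_of_real: "laplace f (of_real s) = of_real (real_laplace f s)"
  unfolding laplace_def real_laplace_def set_integral_complex_of_real[symmetric]
  by (simp add: exp_of_real[symmetric])

lemma laplace_cong: "(\<And>t. t \<ge> 0 \<Longrightarrow> f t = g t) \<Longrightarrow> laplace f s = laplace g s"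
  unfolding laplace_def by (intro set_lebesgue_integral_cong) auto

lemma exp_tail_integral:
  fixes s c :: real
  assumes "s > 0"
  shows exp_tail_integrable: "set_integrable lborel {c..} (\<lambda>t. exp (- (s * t)))"
    and exp_tail_integral_eq: "(LINT t:{c..}|lborel. exp (- (s * t))) = exp (- (s * c)) / s"
proof -
  have hk: "((\<lambda>t. exp (- (s * t))) has_integral exp (- (s * c)) / s) {c..}"
    using has_integral_exp_minus_to_infinity[OF assms, of c] by simp
  have "(\<lambda>t. exp (- (s * t))) absolutely_integrable_on {c..}"
    using hk by (intro nonnegative_absolutely_integrable_1) auto
  thus i: "set_integrable lborel {c..} (\<lambda>t. exp (- (s * t)))"
    unfolding set_integrable_def by (subst (asm) integrable_completion) auto
  show "(LINT t:{c..}|lborel. exp (- (s * t))) = exp (- (s * c)) / s"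
    using set_borel_integral_eq_integral(2)[OF i] hk by (simp add: integral_unique)
qed

lemma laplace_integrable:
  fixes s C :: real
  assumes "s > 0" "set_borel_measurable lborel {0..} f" "\<And>t. t \<ge> 0 \<Longrightarrow> \<bar>f t\<bar> \<le> C"
  shows "set_integrable lborel {0..} (\<lambda>t. exp (- (s * t)) * f t)"
proof (rule set_integrable_bound)
  show "set_integrable lborel {0..} (\<lambda>t. C * exp (- (s * t)))"
    using exp_tail_integrable[OF assms(1)] by (rule set_integrable_mult_right)
  have "(\<lambda>t. exp (- (s * t)) * (indicator {0..} t *\<^sub>R f t)) \<in> borel_measurable lborel"
    using assms(2) unfolding set_borel_measurable_def by measurable
  thus "set_borel_measurable lborel {0..} (\<lambda>t. exp (- (s * t)) * f t)"
    unfolding set_borel_measurable_def by (simp add: ac_simps)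
  show "AE t in lborel. t \<in> {0..} \<longrightarrow> norm (exp (- (s * t)) * f t) \<le> norm (C * exp (- (s * t)))"
    using assms(3) by (intro AE_I2) (force simp: abs_mult mult.commute)
qed

lemma laplace_exp:
  fixes s :: complex and a :: real
  assumes "Re s > 0" "a \<ge> 0"
  shows "has_bochner_integral lborel
      (\<lambda>t. indicator {0..} t *\<^sub>R (exp (- (s * of_real t)) * of_real (exp (- (a * t)))))
      (1 / (s + of_real a))"
proof -
  define c where "c = s + of_real a"
  have c: "Re c > 0" using assms by (simp add: c_def)
  hence c0: "c \<noteq> 0" by auto
  define f where "f t = exp (- (c * of_real t))" for t :: real
  define F where "F t = - exp (- (c * of_real t)) / c" for t :: real
  have integrand: "exp (- (s * of_real t)) * of_real (exp (- (a * t))) = f t" for t :: real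
    by (simp add: f_def c_def exp_of_real[symmetric] exp_add[symmetric] algebra_simps)
  have normf: "norm (f t) = exp (- (Re c * t))" for t
    by (simp add: f_def)
  have f_int: "set_integrable lborel {0..} f"
  proof (rule set_integrable_bound[OF exp_tail_integrable[OF c]])
    show "set_borel_measurable lborel {0..} f"
      unfolding set_borel_measurable_def f_def by measurable
  qed (auto simp: normf)
  have f_int': "set_integrable lborel (einterval 0 \<infinity>) f"
    by (rule set_integrable_subset[OF f_int]) (auto simp: einterval_def zero_ereal_def)
  have "(LBINT t=0..\<infinity>. f t) = 0 - (- 1 / c)"
  proof (rule interval_integral_FTC_integrable[OF _ _ _ f_int'])
    show "(F has_vector_derivative f t) (at t)" for t
      unfolding F_def f_def using c0
      by (auto intro!: derivative_eq_intros has_vector_derivative_real_field simp: field_simps)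
    show "isCont f t" for t unfolding f_def by (intro continuous_intros)
    have "isCont F 0" unfolding F_def using c0 by (intro continuous_intros) auto
    hence "(F \<longlongrightarrow> F 0) (at_right 0)"
      by (simp add: isCont_def filterlim_at_split)
    thus "((F \<circ> real_of_ereal) \<longlongrightarrow> - 1 / c) (at_right 0)"
      by (simp add: zero_ereal_def ereal_tendsto_simps F_def)
    have "((\<lambda>t. exp (- (Re c * t)) / norm c) \<longlongrightarrow> 0 / norm c) at_top"
      using c by (intro tendsto_intros filterlim_compose[OF exp_at_bot]
          filterlim_compose[OF filterlim_uminus_at_bot_at_top]
          filterlim_tendsto_pos_mult_at_top[OF tendsto_const] filterlim_ident) auto
    hence "((\<lambda>t. norm (F t)) \<longlongrightarrow> 0) at_top"
      by (simp add: F_def norm_divide)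
    hence "(F \<longlongrightarrow> 0) at_top" by (rule tendsto_norm_zero_cancel)
    thus "((F \<circ> real_of_ereal) \<longlongrightarrow> 0) (at_left \<infinity>)"
      by (simp add: ereal_tendsto_simps)
  qed simp
  hence "(LINT t:{0<..}|lborel. f t) = 1 / c"
    by (simp add: interval_lebesgue_integral_0_infty)
  moreover have "(LINT t:{0..}|lborel. f t) = (LINT t:{0<..}|lborel. f t)"
  proof (rule set_integral_cong_set)
    show "AE t in lborel. (t \<in> {0<..}) = (t \<in> {0::real..})"
      using AE_lborel_singleton[of 0] by eventually_elim auto
  qed (unfold set_borel_measurable_def f_def, measurable)
  ultimately show ?thesis using f_int
    by (simp add: integrand has_bochner_integral_iff set_integrable_def
        set_lebesgue_integral_def c_def)
qed

text \<open>
  Polynomials in \<open>exp (-t)\<close> form the test class for the upper bounds: their transforms are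
  explicit sums of partial fractions, and they are dense enough to approach bang-bang signals.
\<close>
lemma laplace_poly_exp:
  fixes p :: "real poly"
  assumes "Re s > 0"
  shows "laplace (\<lambda>t. poly p (exp (- t))) s = (\<Sum>k\<le>degree p. of_real (coeff p k) / (s + of_nat k))"
proof -
  have eq: "exp (- (s * of_real t)) * of_real (poly p (exp (- t)))
      = (\<Sum>k\<le>degree p. of_real (coeff p k) * (exp (- (s * of_real t)) * of_real (exp (- (real k * t)))))"
    for t
    by (simp add: poly_altdef sum_distrib_left exp_of_nat_mult[symmetric] exp_of_real[symmetric] mult_ac)
  have "has_bochner_integral lborel
      (\<lambda>t. \<Sum>k\<le>degree p. of_real (coeff p k) *
         (indicator {0..} t *\<^sub>R (exp (- (s * of_real t)) * of_real (exp (- (real k * t))))))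
      (\<Sum>k\<le>degree p. of_real (coeff p k) * (1 / (s + of_real (real k))))"
    using assms by (intro has_bochner_integral_sum has_bochner_integral_mult_right laplace_exp) auto
  thus ?thesis
    unfolding laplace_def set_lebesgue_integral_def eq
    by (auto simp: scaleR_sum_right mult.left_commute has_bochner_integral_iff)
qed

lemma real_laplace_poly_exp:
  fixes p :: "real poly"
  assumes "s > 0"
  shows "real_laplace (\<lambda>t. poly p (exp (- t))) s = (\<Sum>k\<le>degree p. coeff p k / (s + real k))"
proof -
  have "complex_of_real (real_laplace (\<lambda>t. poly p (exp (- t))) s)
      = of_real (\<Sum>k\<le>degree p. coeff p k / (s + real k))"
    using laplace_poly_exp[of "of_real s" p] assms by (simp add: laplace_of_real)
  thus ?thesis by (simp only: of_real_eq_iff)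
qed

lemma poly_exp_in_C0:
  fixes p :: "real poly"
  assumes "poly p 0 = 0"
  shows "(\<lambda>t. poly p (exp (- t))) \<in> C0_half_line"
proof -
  have "((\<lambda>t::real. exp (- t)) \<longlongrightarrow> 0) at_top"
    by (intro filterlim_compose[OF exp_at_bot] filterlim_uminus_at_bot_at_top)
  from tendsto_poly[OF this, of p] have "((\<lambda>t. poly p (exp (- t))) \<longlongrightarrow> 0) at_top"
    by (simp add: assms)
  thus ?thesis by (auto simp: C0_half_line_def intro!: continuous_intros)
qed

text \<open>
  Multiplication by \<open>s\<close>, that is, division by the transform \<open>1 / s\<close> of the reference, turns each
  partial fraction \<open>c / (s + k)\<close> into a proper function with the pole \<open>-k\<close>.  The sum
  is the sensitivity function that a controller has to realise in order to produce the signal.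
\<close>
lemma poly_exp_transform_stable:
  fixes p :: "real poly"
  assumes "poly p 0 = 0"
  obtains S where "S \<in> stable_rat"
    "\<And>s. Re s > 0 \<Longrightarrow> reval S s = s * laplace (\<lambda>t. poly p (exp (- t))) s"
proof
  let ?r = "\<lambda>k. Fract [:0, coeff p k:] [:real k, 1:]"
  let ?S = "\<Sum>k\<in>{1..degree p}. ?r k"
  have nz: "ceval [:real k, 1:] s \<noteq> 0" if "k \<ge> 1" "Re s \<ge> 0" for k s
    using that by (auto simp: ceval_pCons complex_eq_iff)
  have st: "?r k \<in> stable_rat" if "k \<in> {1..degree p}" for k
    using that nz by (intro Fract_stable) auto
  show "?S \<in> stable_rat" using st by (intro stable_sum_closed) auto
  fix s :: complex assume s: "Re s > 0"
  have "reval ?S s = (\<Sum>k\<in>{1..degree p}. reval (?r k) s)"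
    using st s by (intro reval_sum) auto
  also have "\<dots> = (\<Sum>k\<in>{1..degree p}. s * (of_real (coeff p k) / (s + of_nat k)))"
    using s nz by (intro sum.cong) (auto simp: reval_Fract ceval_pCons add.commute)
  also have "\<dots> = (\<Sum>k\<le>degree p. s * (of_real (coeff p k) / (s + of_nat k)))"
    using assms by (intro sum.mono_neutral_left) (auto simp: poly_0_coeff_0 not_le Suc_le_eq)
  finally show "reval ?S s = s * laplace (\<lambda>t. poly p (exp (- t))) s"
    using s by (simp add: laplace_poly_exp sum_distrib_left)
qed

section \<open>Interpolation conditions for closed-loop errors\<close>

locale one_zero_one_pole_plant =
  fixes z1 p1 :: real and n d x v :: ratfun and w :: "real \<Rightarrow> real"
  assumes p1_pos: "p1 > 0" and p1_less_z1: "z1 > p1"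
    and plant: "Fract [:- z1, 1:] [:- p1, 1:] = n / d"
    and stable_factors: "n \<in> stable_rat" "d \<in> stable_rat" "x \<in> stable_rat" "v \<in> stable_rat"
    and bezout: "x * n + v * d = 1"
    and unit_step: "\<And>t. t \<ge> 0 \<Longrightarrow> w t = 1"
begin

abbreviation "errors \<equiv> closed_loop_errors w n d v"
abbreviation "zfac \<equiv> real_zero_factor z1"
abbreviation "pfac \<equiv> real_zero_factor p1"

lemma d_nonzero: "d \<noteq> 0"
proof
  assume "d = 0"
  hence "Fract [:- z1, 1:] [:- p1, 1:] = 0" using plant by simp
  thus False unfolding Zero_fract_def by (simp add: eq_fract(1))
qed

lemma n_pfac_eq_d_zfac: "n * pfac = d * zfac"
proof -
  have "Fract [:- z1, 1:] [:- p1, 1:] * pfac = zfac"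
    unfolding real_zero_factor_def by (simp add: eq_fract del: mult_pCons_left mult_pCons_right) 
  with plant have "n / d * pfac = zfac" by simp
  with d_nonzero show ?thesis by (simp add: field_simps)
qed

lemma z1_pos: "z1 > 0" using p1_pos p1_less_z1 by linarith

lemma reval_d_p1: "reval d (of_real p1) = 0"
proof -
  have "reval (n * pfac) (of_real p1) = reval (d * zfac) (of_real p1)" by (simp only: n_pfac_eq_d_zfac)
  hence "reval d (of_real p1) * ((of_real p1 - of_real z1) / (1 + of_real p1)) = 0"
    using p1_pos by (simp add: reval_mult stable_factors real_zero_factor_stable reval_real_zero_factor)
  moreover have "complex_of_real p1 - of_real z1 \<noteq> 0" "1 + complex_of_real p1 \<noteq> 0"
    using p1_pos p1_less_z1 by (auto simp: complex_eq_iff)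
  ultimately show ?thesis by simp
qed

lemma reval_n_z1: "reval n (of_real z1) = 0"
proof -
  have "reval (n * pfac) (of_real z1) = reval (d * zfac) (of_real z1)" by (simp only: n_pfac_eq_d_zfac)
  hence "reval n (of_real z1) * ((of_real z1 - of_real p1) / (1 + of_real z1)) = 0"
    using z1_pos by (simp add: reval_mult stable_factors real_zero_factor_stable reval_real_zero_factor)
  moreover have "complex_of_real z1 - of_real p1 \<noteq> 0" "1 + complex_of_real z1 \<noteq> 0"
    using z1_pos p1_less_z1 by (auto simp: complex_eq_iff)
  ultimately show ?thesis by simp
qed

lemma reval_dv_z1: "reval (d * v) (of_real z1) = 1"
proof -
  have "d * v = 1 - x * n" using bezout by (simp add: algebra_simps)
  moreover have "1 \<in> stable_rat" using stable_const[of 1] by (simp add: One_fract_def one_pCons)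
  ultimately show ?thesis using z1_pos
    by (simp add: reval_diff reval_mult stable_mult_closed stable_factors reval_1 reval_n_z1)
qed

lemma laplace_w:
  assumes "Re s > 0"
  shows "laplace w s = 1 / s"
proof -
  have "laplace w s = laplace (\<lambda>t. poly 1 (exp (- t))) s"
    by (rule laplace_cong) (simp add: unit_step)
  also have "\<dots> = 1 / s" using laplace_poly_exp[OF assms, of 1] by simp
  finally show ?thesis .
qed

text \<open>
  The sensitivity \<open>d (v - q n)\<close> vanishes at the unstable pole because \<open>d\<close> does, and equals \<open>d v = 1\<close>
  at the unstable zero because \<open>n\<close> vanishes there; the parameter \<open>q\<close> has no influence on either
  value.
\<close>
lemma error_interpolation:
  assumes "e \<in> errors"
  shows "real_laplace e p1 = 0" and "real_laplace e z1 = 1 / z1"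
proof -
  obtain q where q: "q \<in> stable_rat"
    and le: "\<And>s. Re s > 0 \<Longrightarrow> laplace e s = laplace w s * reval (d * (v - q * n)) s"
    using assms by (auto simp: closed_loop_errors_def)
  have st: "q * n \<in> stable_rat" "v - q * n \<in> stable_rat"
    by (intro stable_diff_closed stable_mult_closed stable_factors q)+
  have "reval (d * (v - q * n)) (of_real p1) = 0"
    using p1_pos by (simp add: reval_mult stable_factors st reval_d_p1)
  with le[of "of_real p1"] p1_pos show "real_laplace e p1 = 0"
    by (simp add: laplace_of_real)
  have "reval (v - q * n) (of_real z1) = reval v (of_real z1)"
    using z1_pos q by (simp add: reval_diff reval_mult stable_factors st reval_n_z1)
  hence "reval (d * (v - q * n)) (of_real z1) = 1"
    using reval_dv_z1 z1_pos by (simp add: reval_mult stable_factors st)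
  with le[of "of_real z1"] laplace_w[of "of_real z1"] z1_pos
  have "complex_of_real (real_laplace e z1) = of_real (1 / z1)"
    by (simp add: laplace_of_real[symmetric])
  thus "real_laplace e z1 = 1 / z1" by (simp only: of_real_eq_iff)
qed

text \<open>
  The two interpolation conditions suffice.  With them, \<open>d v - S\<close> vanishes at \<open>z1\<close> and at \<open>p1\<close>, so
  both zeros can be divided out.  What remains of \<open>n\<close> and \<open>d\<close> after removal of these zeros is
  a unit of the ring of stable functions; the Bezout identity exhibits its inverse.
\<close>
lemma stable_controller_parameter:
  assumes S: "S \<in> stable_rat" and Sp: "reval S (of_real p1) = 0" and Sz: "reval S (of_real z1) = 1"
  obtains q where "q \<in> stable_rat" "S = d * (v - q * n)"
proof -
  define f where "f = d * v - S"
  have f: "f \<in> stable_rat"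
    unfolding f_def by (intro stable_diff_closed stable_mult_closed stable_factors S)
  have fp: "reval f (of_real p1) = 0" and fz: "reval f (of_real z1) = 0"
    unfolding f_def using p1_pos z1_pos reval_dv_z1 Sp Sz
    by (simp_all add: reval_diff reval_mult stable_mult_closed stable_factors S reval_d_p1)
  obtain f1 where f1: "f1 \<in> stable_rat" "f = zfac * f1"
    using stable_cancel_zero[OF f _ fz] z1_pos by auto
  have "(of_real p1 - of_real z1) / (1 + of_real p1) * reval f1 (of_real p1) = 0"
    using fp p1_pos
    by (simp add: f1 reval_mult real_zero_factor_stable reval_real_zero_factor)
  moreover have "complex_of_real p1 - of_real z1 \<noteq> 0" "1 + complex_of_real p1 \<noteq> 0"
    using p1_pos p1_less_z1 by (auto simp: complex_eq_iff)
  ultimately have "reval f1 (of_real p1) = 0" by simp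
  then obtain f2 where f2: "f2 \<in> stable_rat" "f1 = pfac * f2"
    using stable_cancel_zero[OF f1(1), of p1] p1_pos by auto
  \<comment> \<open>By the Bezout identity, \<open>g\<close> is the inverse of the common factor \<open>n / zfac = d / pfac\<close>.\<close>
  define g where "g = x * zfac + v * pfac"
  have g: "g \<in> stable_rat"
    unfolding g_def
    by (intro stable_add_closed stable_mult_closed stable_factors real_zero_factor_stable)
  have "g * d = x * (d * zfac) + v * d * pfac" by (simp add: g_def algebra_simps)
  also have "\<dots> = (x * n + v * d) * pfac" by (simp add: n_pfac_eq_d_zfac[symmetric] algebra_simps)
  finally have gd: "g * d = pfac" by (simp add: bezout)
  have "g * n = x * n * zfac + v * (n * pfac)" by (simp add: g_def algebra_simps)
  also have "\<dots> = (x * n + v * d) * zfac" by (simp add: n_pfac_eq_d_zfac algebra_simps)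
  finally have gn: "g * n = zfac" by (simp add: bezout)
  show ?thesis
  proof
    show "g * g * f2 \<in> stable_rat" by (intro stable_mult_closed g f2)
    have "d * (g * g * f2 * n) = (g * d) * (g * n) * f2" by (simp add: algebra_simps)
    also have "\<dots> = pfac * zfac * f2" by (simp only: gd gn)
    also have "\<dots> = d * v - S" by (simp add: f1 f2 f_def[symmetric] mult_ac)
    finally show "S = d * (v - g * g * f2 * n)" by (simp add: algebra_simps)
  qed
qed

lemma poly_exp_closed_loop_error:
  fixes p :: "real poly"
  defines "e \<equiv> \<lambda>t. poly p (exp (- t))"
  assumes "poly p 0 = 0" "real_laplace e p1 = 0" "real_laplace e z1 = 1 / z1"
  shows "e \<in> errors"
proof -
  obtain S where S: "S \<in> stable_rat" "\<And>s. Re s > 0 \<Longrightarrow> reval S s = s * laplace e s"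
    using poly_exp_transform_stable[OF assms(2)] unfolding e_def by blast
  have "reval S (of_real p1) = 0" "reval S (of_real z1) = 1"
    using S(2) assms(3,4) p1_pos z1_pos by (simp_all add: laplace_of_real)
  then obtain q where q: "q \<in> stable_rat" "S = d * (v - q * n)"
    using stable_controller_parameter[OF S(1)] by blast
  have "laplace e s = laplace w s * reval (d * (v - q * n)) s" if "Re s > 0" for s
  proof -
    have "s \<noteq> 0" using that by auto
    thus ?thesis using S(2)[OF that] by (simp add: laplace_w[OF that] q(2)[symmetric])
  qed
  with q(1) poly_exp_in_C0[OF assms(2)] show ?thesis
    unfolding closed_loop_errors_def e_def by blast
qed

end

section \<open>Lower bounds from bang-bang test signals\<close>

lemma real_laplace_step:
  fixes s T M m :: real
  assumes "s > 0" "T \<ge> 0"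
  shows "set_integrable lborel {0..} (\<lambda>t. exp (- (s * t)) * (if t < T then M else - m))"
    and "real_laplace (\<lambda>t. if t < T then M else - m) s = (M - (M + m) * exp (- (s * T))) / s"
proof -
  let ?b = "\<lambda>t. if t < T then M else - m"
  show int: "set_integrable lborel {0..} (\<lambda>t. exp (- (s * t)) * ?b t)"
  proof (rule laplace_integrable[OF assms(1)])
    show "set_borel_measurable lborel {0..} ?b"
      unfolding set_borel_measurable_def by measurable
    show "\<bar>?b t\<bar> \<le> \<bar>M\<bar> + \<bar>m\<bar>" for t by auto
  qed
  note tail = exp_tail_integrable[OF assms(1)] exp_tail_integral_eq[OF assms(1)]
  have ind: "indicator {0..} t *\<^sub>R (exp (- (s * t)) * ?b t)
      = M * (indicator {0..} t *\<^sub>R exp (- (s * t))) - (M + m) * (indicator {T..} t *\<^sub>R exp (- (s * t)))"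
    for t using assms(2) by (auto simp: indicator_def algebra_simps)
  have "real_laplace ?b s
      = M * (LINT t:{0..}|lborel. exp (- (s * t))) - (M + m) * (LINT t:{T..}|lborel. exp (- (s * t)))"
    unfolding real_laplace_def set_lebesgue_integral_def ind
    using tail(1)[of 0] tail(1)[of T] by (simp add: set_integrable_def)
  thus "real_laplace ?b s = (M - (M + m) * exp (- (s * T))) / s"
    by (simp add: tail(2) diff_divide_distrib)
qed

lemma C0_half_line_bounded:
  assumes "e \<in> C0_half_line"
  obtains C where "\<And>t. t \<ge> 0 \<Longrightarrow> \<bar>e t\<bar> \<le> C"
proof -
  have cont: "continuous_on {0..} e" and lim: "(e \<longlongrightarrow> 0) at_top"
    using assms by (auto simp: C0_half_line_def)
  have "\<forall>\<^sub>F t in at_top. \<bar>e t\<bar> < 1"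
    using tendstoD[OF lim, of 1] by (simp add: dist_real_def)
  then obtain T where T: "\<And>t. t \<ge> T \<Longrightarrow> \<bar>e t\<bar> < 1"
    unfolding eventually_at_top_linorder by blast
  have "compact (e ` {0..T})"
    by (intro compact_continuous_image continuous_on_subset[OF cont]) auto
  then obtain B where B: "\<forall>t\<in>{0..T}. \<bar>e t\<bar> \<le> B"
    using compact_imp_bounded[of "e ` {0..T}"] by (auto simp: bounded_real)
  show ?thesis
  proof
    show "\<bar>e t\<bar> \<le> max B 1" if "t \<ge> 0" for t
      using that B[rule_format, of t] T[of t] by (cases "t \<le> T") auto
  qed
qed

lemma C0_laplace_integrable:
  assumes "e \<in> C0_half_line" "s > 0"
  shows "set_integrable lborel {0..} (\<lambda>t. exp (- (s * t)) * e t)"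
proof -
  obtain C where C: "\<And>t. t \<ge> 0 \<Longrightarrow> \<bar>e t\<bar> \<le> C" using C0_half_line_bounded[OF assms(1)] by blast
  have "continuous_on {0..} e" using assms(1) by (simp add: C0_half_line_def)
  hence "set_borel_measurable lborel {0..} e"
    using borel_measurable_continuous_on_indicator[of "{0..}" e]
    by (simp add: set_borel_measurable_def)
  from laplace_integrable[OF assms(2) this C] show ?thesis .
qed

context one_zero_one_pole_plant
begin

text \<open>
  Weak duality.  With \<open>c = exp (-(z1 - p1) T)\<close>, the weight \<open>exp (-z1 t) - c exp (-p1 t)\<close> is nonnegative before \<open>T\<close> and
  nonpositive afterwards, so among all signals between \<open>-m\<close> and \<open>M\<close> its integral is largest for
  the signal that switches from \<open>M\<close> to \<open>-m\<close> at \<open>T\<close>.  For the error, the same integral is fixed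
  by the interpolation conditions.
\<close>
lemma bang_bang_bound:
  fixes M m T :: real
  assumes e: "e \<in> errors"
    and bd: "\<And>t. t \<ge> 0 \<Longrightarrow> - m \<le> e t \<and> e t \<le> M" and T: "T \<ge> 0"
  shows "1 / z1 \<le> (M - (M + m) * exp (- (z1 * T))) / z1
      - exp (- ((z1 - p1) * T)) * ((M - (M + m) * exp (- (p1 * T))) / p1)"
proof -
  define b where "b t = (if t < T then M else - m)" for t
  define c where "c = exp (- ((z1 - p1) * T))"
  have C0: "e \<in> C0_half_line" using e by (simp add: closed_loop_errors_def)
  note step = real_laplace_step[OF _ T, of _ M m, folded b_def]
  define G where "G f t = exp (- (z1 * t)) * f t - c * (exp (- (p1 * t)) * f t)" for f :: "real \<Rightarrow> real" and t
  have G: "set_integrable lborel {0..} (G f)"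
    "(LINT t:{0..}|lborel. G f t) = real_laplace f z1 - c * real_laplace f p1"
    if "set_integrable lborel {0..} (\<lambda>t. exp (- (z1 * t)) * f t)"
       "set_integrable lborel {0..} (\<lambda>t. exp (- (p1 * t)) * f t)" for f
    using that unfolding G_def real_laplace_def by simp_all
  note Ge = G[OF C0_laplace_integrable[OF C0 z1_pos] C0_laplace_integrable[OF C0 p1_pos]]
  note Gb = G[OF step(1)[OF z1_pos] step(1)[OF p1_pos]]
  have "(LINT t:{0..}|lborel. G e t) \<le> (LINT t:{0..}|lborel. G b t)"
  proof (rule set_integral_mono[OF Ge(1) Gb(1)])
    fix t :: real assume "t \<in> {0..}"
    hence t: "- m \<le> e t" "e t \<le> M" using bd by auto
    have fac: "G f t = exp (- (p1 * t)) * (exp (- ((z1 - p1) * t)) - c) * f t" for f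
      by (simp add: G_def exp_add[symmetric] algebra_simps)
    show "G e t \<le> G b t"
    proof (cases "t < T")
      case True
      hence "c \<le> exp (- ((z1 - p1) * t))" using p1_less_z1 by (simp add: c_def)
      thus ?thesis unfolding fac using True t by (intro mult_left_mono) (auto simp: b_def)
    next
      case False
      hence "exp (- ((z1 - p1) * t)) \<le> c" using p1_less_z1 by (simp add: c_def)
      thus ?thesis unfolding fac using False t
        by (intro mult_left_mono_neg) (auto simp: b_def mult_le_0_iff)
    qed
  qed
  thus ?thesis
    using error_interpolation[OF e] by (simp add: Ge(2) Gb(2) step(2) p1_pos z1_pos c_def)
qed

text \<open>
  This is the case \<open>T = \<infinity>\<close> of the duality bound, with the weight \<open>exp (-z1 t)\<close> alone.
\<close>
lemma error_sup_ge_1: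
  assumes e: "e \<in> errors" and bd: "\<And>t. t \<ge> 0 \<Longrightarrow> e t \<le> M"
  shows "1 \<le> M"
proof -
  have C0: "e \<in> C0_half_line" using e by (simp add: closed_loop_errors_def)
  have "real_laplace e z1 \<le> real_laplace (\<lambda>t. if t < 0 then M else - (- M)) z1"
    unfolding real_laplace_def
    by (rule set_integral_mono[OF C0_laplace_integrable[OF C0 z1_pos] real_laplace_step(1)[OF z1_pos]])
      (use bd in auto)
  hence "1 / z1 \<le> M / z1"
    using real_laplace_step(2)[OF z1_pos, of 0 M "- M"] error_interpolation(2)[OF e] by simp
  thus ?thesis using z1_pos by (simp add: divide_le_cancel)
qed

end

section \<open>Admissible errors close to a bang-bang signal\<close>

text \<open>
  In the variable \<open>y = exp (-t)\<close>, the factor \<open>A\<close> switches near \<open>y = exp (-T)\<close>: it behaves like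
  \<open>exp (- exp (N (T - t)))\<close>, hence tends to 0 before \<open>T\<close> and to 1 after \<open>T\<close>.  The factor
  \<open>1 - B\<close> tends to 1 at every finite time but vanishes at \<open>y = 0\<close>, which makes the signal decay at
  infinity.
\<close>
definition soft_step :: "real \<Rightarrow> real \<Rightarrow> real \<Rightarrow> nat \<Rightarrow> real poly" where
  "soft_step M m T N =
     (let A = (1 - monom 1 N) ^ nat \<lceil>exp (real N * T)\<rceil>; B = (1 - monom 1 1) ^ N
      in smult M (1 - A) - smult m (A * (1 - B)))"

lemma poly_soft_step:
  "poly (soft_step M m T N) y =
     M * (1 - (1 - y ^ N) ^ nat \<lceil>exp (real N * T)\<rceil>)
     - m * ((1 - y ^ N) ^ nat \<lceil>exp (real N * T)\<rceil> * (1 - (1 - y) ^ N))"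
  by (simp add: soft_step_def Let_def poly_monom)

lemma soft_step_0: "N > 0 \<Longrightarrow> poly (soft_step M m T N) 0 = 0"
  by (simp add: poly_soft_step zero_power)

text \<open>
  The value is a convex combination of \<open>M\<close>, \<open>-m\<close> and \<open>0\<close> with weights \<open>1 - A\<close>, \<open>A (1 - B)\<close> and
  \<open>A B\<close>, so the approximation never leaves the band between the two levels.
\<close>
lemma soft_step_bounds:
  assumes "0 \<le> y" "y \<le> 1" "0 \<le> M" "0 \<le> m"
  shows "- m \<le> poly (soft_step M m T N) y" "poly (soft_step M m T N) y \<le> M"
proof -
  define A where "A = (1 - y ^ N) ^ nat \<lceil>exp (real N * T)\<rceil>"
  define B where "B = (1 - y) ^ N"
  have A: "0 \<le> A" "A \<le> 1" unfolding A_def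
    using assms by (auto intro!: power_le_one zero_le_power simp: power_le_one)
  have B: "0 \<le> B" "B \<le> 1" unfolding B_def using assms by (auto intro!: power_le_one)
  have AB: "0 \<le> A * (1 - B)" "A * (1 - B) \<le> 1"
    using A B by (auto intro: mult_le_one)
  have "0 \<le> M * (1 - A)" "M * (1 - A) \<le> M" using A assms by (auto intro: mult_left_le)
  moreover have "0 \<le> m * (A * (1 - B))" "m * (A * (1 - B)) \<le> m"
    using AB assms by (auto intro!: mult_nonneg_nonneg intro: mult_left_le)
  ultimately show "- m \<le> poly (soft_step M m T N) y" "poly (soft_step M m T N) y \<le> M"
    unfolding poly_soft_step A_def[symmetric] B_def[symmetric] by linarith+
qed

lemma soft_step_tendsto:
  assumes t: "t > 0" and T: "T \<ge> 0" and ne: "t \<noteq> T"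
  shows "(\<lambda>N. poly (soft_step M m T N) (exp (- t))) \<longlonglongrightarrow> (if t < T then M else - m)"
proof -
  define K where "K N = nat \<lceil>exp (real N * T)\<rceil>" for N
  define A where "A N = (1 - exp (- t) ^ N) ^ K N" for N
  have K: "exp (real N * T) \<le> K N" "K N \<le> exp (real N * T) + 1" for N
    unfolding K_def by (linarith | simp)+
  have pw: "exp (- t) ^ N = exp (- (real N * t))" for N
    by (simp add: exp_of_nat_mult[symmetric])
  have le1: "exp (- t) ^ N \<le> 1" for N using t by (simp add: pw)
  have A01: "0 \<le> A N" "A N \<le> 1" for N
    unfolding A_def using le1 by (auto intro!: power_le_one)
  have lim: "A \<longlonglongrightarrow> (if t < T then 0 else 1)"
  proof (cases "t < T")
    case True
    have "\<forall>N. A N \<le> exp (- exp (real N * (T - t)))"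
    proof
      fix N
      have "1 - exp (- t) ^ N \<le> exp (- (exp (- t) ^ N))"
        using exp_ge_add_one_self[of "- (exp (- t) ^ N)"] by simp
      hence "A N \<le> exp (- (exp (- t) ^ N)) ^ K N"
        unfolding A_def using le1 by (intro power_mono) auto
      also have "\<dots> = exp (- (real (K N) * exp (- t) ^ N))"
        by (simp add: exp_of_nat_mult[symmetric])
      also have "\<dots> \<le> exp (- (exp (real N * T) * exp (- t) ^ N))"
        using K(1)[of N] by (simp add: mult_right_mono)
      also have "exp (real N * T) * exp (- t) ^ N = exp (real N * (T - t))"
        by (simp add: pw exp_add[symmetric] algebra_simps)
      finally show "A N \<le> exp (- exp (real N * (T - t)))" .
    qed
    moreover have "(\<lambda>N. exp (- exp (real N * (T - t)))) \<longlonglongrightarrow> 0"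
      using True by real_asymp
    ultimately have "A \<longlonglongrightarrow> 0"
      by (intro tendsto_sandwich[where f = "\<lambda>_. 0" and g = A, OF always_eventually always_eventually tendsto_const])
        (simp_all add: A01)
    with True show ?thesis by simp
  next
    case False
    with ne have tT: "t > T" by simp
    have "\<forall>N. 1 - (exp (real N * (T - t)) + exp (- (real N * t))) \<le> A N"
    proof
      fix N
      have "real (K N) * exp (- t) ^ N \<le> (exp (real N * T) + 1) * exp (- t) ^ N"
        using K(2)[of N] by (intro mult_right_mono) auto
      also have "\<dots> = exp (real N * (T - t)) + exp (- (real N * t))"
        by (simp add: pw exp_add[symmetric] algebra_simps)
      moreover have "1 + real (K N) * (- (exp (- t) ^ N)) \<le> (1 + - (exp (- t) ^ N)) ^ K N"
        using le1[of N] by (intro Bernoulli_inequality) auto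
      ultimately show "1 - (exp (real N * (T - t)) + exp (- (real N * t))) \<le> A N"
        by (simp add: A_def)
    qed
    moreover have "(\<lambda>N. 1 - (exp (real N * (T - t)) + exp (- (real N * t)))) \<longlonglongrightarrow> 1"
    proof -
      have "(\<lambda>N. 1 - (exp (- (t - T)) ^ N + exp (- t) ^ N)) \<longlonglongrightarrow> 1 - (0 + 0)"
        using tT t by (intro tendsto_intros LIMSEQ_realpow_zero) auto
      moreover have "exp (- (t - T)) ^ N = exp (real N * (T - t))" for N
        by (simp add: exp_of_nat_mult[symmetric])
      ultimately show ?thesis by (simp add: pw)
    qed
    ultimately have "A \<longlonglongrightarrow> 1"
      by (intro tendsto_sandwich[where h = "\<lambda>_. 1" and g = A, OF always_eventually always_eventually _ tendsto_const])
        (simp_all add: A01)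
    with False show ?thesis by simp
  qed
  have "(\<lambda>N. (1 - exp (- t)) ^ N) \<longlonglongrightarrow> 0"
    using t by (intro LIMSEQ_realpow_zero) auto
  with lim have "(\<lambda>N. M * (1 - A N) - m * (A N * (1 - (1 - exp (- t)) ^ N)))
      \<longlonglongrightarrow> M * (1 - (if t < T then 0 else 1)) - m * ((if t < T then 0 else 1) * (1 - 0))"
    by (intro tendsto_mult tendsto_diff tendsto_const)
  thus ?thesis
    by (simp add: poly_soft_step A_def K_def split: if_splits)
qed

lemma real_laplace_soft_step_tendsto:
  assumes s: "s > 0" and T: "T \<ge> 0" and Mm: "0 \<le> M" "0 \<le> m"
  shows "(\<lambda>N. real_laplace (\<lambda>t. poly (soft_step M m T N) (exp (- t))) s)
    \<longlonglongrightarrow> (M - (M + m) * exp (- (s * T))) / s"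
proof -
  have "(\<lambda>N. real_laplace (\<lambda>t. poly (soft_step M m T N) (exp (- t))) s)
    \<longlonglongrightarrow> real_laplace (\<lambda>t. if t < T then M else - m) s"
    unfolding real_laplace_def set_lebesgue_integral_def
  proof (rule integral_dominated_convergence)
    show "integrable lborel (\<lambda>t. indicator {0..} t *\<^sub>R ((M + m) * exp (- (s * t))))"
      using set_integrable_mult_right[OF exp_tail_integrable[OF s], of 0 "M + m"]
      by (simp add: set_integrable_def)
    show "AE t in lborel. (\<lambda>N. indicator {0..} t *\<^sub>R (exp (- (s * t)) * poly (soft_step M m T N) (exp (- t))))
        \<longlonglongrightarrow> indicator {0..} t *\<^sub>R (exp (- (s * t)) * (if t < T then M else - m))"
      using AE_lborel_singleton[of 0] AE_lborel_singleton[of T]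
    proof eventually_elim
      case (elim t)
      show ?case
      proof (cases "t > 0")
        case True
        with elim T show ?thesis by (intro tendsto_intros soft_step_tendsto) auto
      next
        case False
        with elim show ?thesis by simp
      qed
    qed
    show "AE t in lborel. norm (indicator {0..} t *\<^sub>R (exp (- (s * t)) * poly (soft_step M m T N) (exp (- t))))
        \<le> indicator {0..} t *\<^sub>R ((M + m) * exp (- (s * t)))" for N
    proof (rule AE_I2)
      fix t :: real
      show "norm (indicator {0..} t *\<^sub>R (exp (- (s * t)) * poly (soft_step M m T N) (exp (- t))))
        \<le> indicator {0..} t *\<^sub>R ((M + m) * exp (- (s * t)))"
      proof (cases "t \<ge> 0")
        case True
        hence "\<bar>poly (soft_step M m T N) (exp (- t))\<bar> \<le> M + m"
          using soft_step_bounds[of "exp (- t)" M m T N] Mm by (simp add: abs_le_iff)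
        thus ?thesis using True by (simp add: abs_mult mult.commute)
      qed simp
    qed
    show "(\<lambda>t. indicator {0..} t *\<^sub>R (exp (- (s * t)) * (if t < T then M else - m))) \<in> borel_measurable lborel"
      by measurable
    show "(\<lambda>t. indicator {0..} t *\<^sub>R (exp (- (s * t)) * poly (soft_step M m T N) (exp (- t)))) \<in> borel_measurable lborel" for N
      unfolding poly_soft_step by measurable
  qed
  thus ?thesis by (simp add: real_laplace_step(2)[OF s T])
qed

lemma real_laplace_two_exps:
  assumes "s > 0"
  shows "real_laplace (\<lambda>t. poly [:0, c\<^sub>1, c\<^sub>2:] (exp (- t))) s = c\<^sub>1 / (s + 1) + c\<^sub>2 / (s + 2)"
proof -
  let ?r = "[:0, c\<^sub>1, c\<^sub>2:]"
  have deg: "degree ?r \<le> 2" by (simp add: degree_pCons_le)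
  have "(\<Sum>k\<le>degree ?r. coeff ?r k / (s + real k)) = (\<Sum>k\<le>2. coeff ?r k / (s + real k))"
    using deg by (intro sum.mono_neutral_left) (auto simp: not_le coeff_eq_0 simp del: degree_pCons_eq_if)
  also have "\<dots> = c\<^sub>1 / (s + 1) + c\<^sub>2 / (s + 2)" by (simp add: numeral_2_eq_2)
  finally show ?thesis using assms by (simp only: real_laplace_poly_exp)
qed

lemma real_laplace_poly_exp_add:
  assumes "s > 0"
  shows "real_laplace (\<lambda>t. poly (p + q) (exp (- t))) s
    = real_laplace (\<lambda>t. poly p (exp (- t))) s + real_laplace (\<lambda>t. poly q (exp (- t))) s"
proof -
  have int: "set_integrable lborel {0..} (\<lambda>t. exp (- (s * t)) * poly r (exp (- t)))" for r :: "real poly"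
  proof -
    have "compact (poly r ` {0..1})" by (intro compact_continuous_image continuous_intros) auto
    then obtain C where C: "\<forall>y\<in>{0..1}. \<bar>poly r y\<bar> \<le> C"
      using compact_imp_bounded[of "poly r ` {0..1}"] by (auto simp: bounded_real)
    have "(\<lambda>t::real. poly r (exp (- t))) \<in> borel_measurable borel"
      by (intro borel_measurable_continuous_onI continuous_intros)
    hence "set_borel_measurable lborel {0..} (\<lambda>t. poly r (exp (- t)))"
      unfolding set_borel_measurable_def by simp
    thus ?thesis using C by (intro laplace_integrable[OF assms, of _ C]) auto
  qed
  show ?thesis using int[of p] int[of q]
    unfolding real_laplace_def by (simp add: distrib_left)
qed

context one_zero_one_pole_plant
begin

text \<open>
  The levels of the bang-bang signal with switching time \<open>T\<close>: the values \<open>- undershoot T\<close> and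
  \<open>overshoot T\<close> solve the two linear interpolation conditions.
\<close>
definition "undershoot T = (1 - exp (- (p1 * T))) / (exp (- (p1 * T)) - exp (- (z1 * T)))"
definition "overshoot T = exp (- (p1 * T)) / (exp (- (p1 * T)) - exp (- (z1 * T)))"

lemma undershoot_nonneg: "T > 0 \<Longrightarrow> undershoot T \<ge> 0"
  unfolding undershoot_def using p1_pos p1_less_z1 by (intro divide_nonneg_nonneg) auto

lemma overshoot_nonneg: "T > 0 \<Longrightarrow> overshoot T \<ge> 0"
  unfolding overshoot_def using p1_less_z1 by (intro divide_nonneg_nonneg) auto

text \<open>
  The transforms of the soft steps converge, so the interpolation conditions are violated only by
  amounts tending to zero.  Adding \<open>c\<^sub>1 exp (-t) + c\<^sub>2 exp (-2t)\<close> restores them exactly, and the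
  coefficients tend to zero as well because the two equations for them are independent for
  \<open>p1 \<noteq> z1\<close>.
\<close>
lemma near_bang_bang_error:
  fixes T \<epsilon> :: real
  assumes T: "T > 0" and \<epsilon>: "\<epsilon> > 0"
  shows "\<exists>e\<in>errors. \<forall>t\<ge>0. - undershoot T - \<epsilon> \<le> e t \<and> e t \<le> overshoot T + \<epsilon>"
proof -
  define D where "D = exp (- (p1 * T)) - exp (- (z1 * T))"
  define M where "M = overshoot T"
  define m where "m = undershoot T"
  have D: "D > 0" using T p1_less_z1 by (simp add: D_def)
  have Mm: "0 \<le> M" "0 \<le> m" using T by (simp_all add: M_def m_def overshoot_nonneg undershoot_nonneg)
  have M: "M = exp (- (p1 * T)) / D" by (simp add: M_def overshoot_def D_def)
  have sum: "M + m = 1 / D"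
    by (simp add: M_def m_def overshoot_def undershoot_def D_def add_divide_distrib[symmetric])
  define q where "q N = soft_step M m T N" for N
  define \<delta>\<^sub>p where "\<delta>\<^sub>p N = - real_laplace (\<lambda>t. poly (q N) (exp (- t))) p1" for N
  define \<delta>\<^sub>z where "\<delta>\<^sub>z N = 1 / z1 - real_laplace (\<lambda>t. poly (q N) (exp (- t))) z1" for N
  have "M - (M + m) * exp (- (p1 * T)) = 0" unfolding sum by (simp add: M)
  with real_laplace_soft_step_tendsto[OF p1_pos _ Mm, of T] T
  have "(\<lambda>N. real_laplace (\<lambda>t. poly (q N) (exp (- t))) p1) \<longlonglongrightarrow> 0" by (simp add: q_def)
  hence \<delta>p: "\<delta>\<^sub>p \<longlonglongrightarrow> 0" unfolding \<delta>\<^sub>p_def by (auto intro!: tendsto_eq_intros)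
  have "M - (M + m) * exp (- (z1 * T)) = 1"
    unfolding sum using D by (simp add: M diff_divide_distrib[symmetric]) (simp add: D_def)
  with real_laplace_soft_step_tendsto[OF z1_pos _ Mm, of T] T
  have "(\<lambda>N. real_laplace (\<lambda>t. poly (q N) (exp (- t))) z1) \<longlonglongrightarrow> 1 / z1" by (simp add: q_def)
  hence \<delta>z: "\<delta>\<^sub>z \<longlonglongrightarrow> 0" unfolding \<delta>\<^sub>z_def by (auto intro!: tendsto_eq_intros)
  \<comment> \<open>Cramer's rule for \<open>c\<^sub>1 / (s + 1) + c\<^sub>2 / (s + 2) = \<delta>\<close> at \<open>s = p1\<close> and \<open>s = z1\<close>.\<close>
  define c\<^sub>1 where "c\<^sub>1 N = (p1 + 1) * (z1 + 1) / (z1 - p1) * ((p1 + 2) * \<delta>\<^sub>p N - (z1 + 2) * \<delta>\<^sub>z N)" for N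
  define c\<^sub>2 where "c\<^sub>2 N = (p1 + 2) * (z1 + 2) / (z1 - p1) * ((z1 + 1) * \<delta>\<^sub>z N - (p1 + 1) * \<delta>\<^sub>p N)" for N
  have solve_p: "c\<^sub>1 N / (p1 + 1) + c\<^sub>2 N / (p1 + 2) = \<delta>\<^sub>p N" for N
  proof -
    have "c\<^sub>1 N / (p1 + 1) = (z1 + 1) * ((p1 + 2) * \<delta>\<^sub>p N - (z1 + 2) * \<delta>\<^sub>z N) / (z1 - p1)"
      "c\<^sub>2 N / (p1 + 2) = (z1 + 2) * ((z1 + 1) * \<delta>\<^sub>z N - (p1 + 1) * \<delta>\<^sub>p N) / (z1 - p1)"
      using p1_pos by (simp_all add: c\<^sub>1_def c\<^sub>2_def)
    hence "c\<^sub>1 N / (p1 + 1) + c\<^sub>2 N / (p1 + 2) = (z1 - p1) * \<delta>\<^sub>p N / (z1 - p1)"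
      by (simp only: add_divide_distrib[symmetric]) (simp add: algebra_simps)
    thus ?thesis using p1_less_z1 by simp
  qed
  have solve_z: "c\<^sub>1 N / (z1 + 1) + c\<^sub>2 N / (z1 + 2) = \<delta>\<^sub>z N" for N
  proof -
    have "c\<^sub>1 N / (z1 + 1) = (p1 + 1) * ((p1 + 2) * \<delta>\<^sub>p N - (z1 + 2) * \<delta>\<^sub>z N) / (z1 - p1)"
      "c\<^sub>2 N / (z1 + 2) = (p1 + 2) * ((z1 + 1) * \<delta>\<^sub>z N - (p1 + 1) * \<delta>\<^sub>p N) / (z1 - p1)"
      using z1_pos by (simp_all add: c\<^sub>1_def c\<^sub>2_def)
    hence "c\<^sub>1 N / (z1 + 1) + c\<^sub>2 N / (z1 + 2) = (z1 - p1) * \<delta>\<^sub>z N / (z1 - p1)"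
      by (simp only: add_divide_distrib[symmetric]) (simp add: algebra_simps)
    thus ?thesis using p1_less_z1 by simp
  qed
  have "c\<^sub>1 \<longlonglongrightarrow> 0" "c\<^sub>2 \<longlonglongrightarrow> 0"
    unfolding c\<^sub>1_def c\<^sub>2_def by (rule tendsto_eq_intros \<delta>p \<delta>z refl | simp)+
  hence "\<forall>\<^sub>F N in sequentially. \<bar>c\<^sub>1 N\<bar> < \<epsilon> / 2 \<and> \<bar>c\<^sub>2 N\<bar> < \<epsilon> / 2 \<and> N > 0"
    using tendstoD[of c\<^sub>1 0 sequentially "\<epsilon> / 2"] tendstoD[of c\<^sub>2 0 sequentially "\<epsilon> / 2"] \<epsilon>
    by (intro eventually_conj eventually_gt_at_top) (auto simp: dist_real_def)
  then obtain N where N: "\<bar>c\<^sub>1 N\<bar> < \<epsilon> / 2" "\<bar>c\<^sub>2 N\<bar> < \<epsilon> / 2" "N > 0"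
    using eventually_happens'[OF sequentially_bot] by blast
  define r where "r = q N + [:0, c\<^sub>1 N, c\<^sub>2 N:]"
  have lap: "real_laplace (\<lambda>t. poly r (exp (- t))) s
      = real_laplace (\<lambda>t. poly (q N) (exp (- t))) s + (c\<^sub>1 N / (s + 1) + c\<^sub>2 N / (s + 2))"
    if "s > 0" for s
    unfolding r_def using that by (simp only: real_laplace_poly_exp_add real_laplace_two_exps)
  have "(\<lambda>t. poly r (exp (- t))) \<in> errors"
  proof (rule poly_exp_closed_loop_error)
    show "poly r 0 = 0" using soft_step_0[OF N(3)] by (simp add: r_def q_def)
    show "real_laplace (\<lambda>t. poly r (exp (- t))) p1 = 0"
      unfolding lap[OF p1_pos] solve_p by (simp add: \<delta>\<^sub>p_def)
    show "real_laplace (\<lambda>t. poly r (exp (- t))) z1 = 1 / z1"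
      unfolding lap[OF z1_pos] solve_z by (simp add: \<delta>\<^sub>z_def)
  qed
  moreover have "- m - \<epsilon> \<le> poly r (exp (- t)) \<and> poly r (exp (- t)) \<le> M + \<epsilon>" if "t \<ge> 0" for t
  proof -
    define y where "y = exp (- t)"
    have y: "0 \<le> y" "y \<le> 1" using that by (auto simp: y_def)
    have "\<bar>c\<^sub>1 N * y\<bar> \<le> \<bar>c\<^sub>1 N\<bar>" "\<bar>c\<^sub>2 N * (y * y)\<bar> \<le> \<bar>c\<^sub>2 N\<bar>"
      using y by (auto simp: abs_mult intro!: mult_left_le mult_le_one)
    moreover have "poly r y = poly (q N) y + (c\<^sub>1 N * y + c\<^sub>2 N * (y * y))"
      by (simp add: r_def algebra_simps)
    moreover have "- m \<le> poly (q N) y" "poly (q N) y \<le> M"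
      unfolding q_def using soft_step_bounds[OF y Mm] by auto
    ultimately show ?thesis using N(1,2) unfolding y_def[symmetric] abs_le_iff by linarith
  qed
  ultimately show ?thesis unfolding M_def[symmetric] m_def[symmetric] by (intro bexI) auto
qed

section \<open>The four optimal values\<close>

lemma undershoot_limit: "(undershoot \<longlongrightarrow> p1 / (z1 - p1)) (at_right 0)"
  unfolding undershoot_def using p1_pos p1_less_z1 by real_asymp (simp add: divide_inverse)

lemma overshoot_limit: "(overshoot \<longlongrightarrow> 1) at_top"
proof -
  have eq: "overshoot T = 1 / (1 - exp (- ((z1 - p1) * T)))" for T
  proof -
    have "exp (- (p1 * T)) - exp (- (z1 * T)) = exp (- (p1 * T)) * (1 - exp (- ((z1 - p1) * T)))"
      by (simp add: algebra_simps exp_add[symmetric])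
    thus ?thesis by (simp add: overshoot_def)
  qed
  have "z1 - p1 > 0" using p1_less_z1 by simp
  thus ?thesis unfolding eq by real_asymp
qed

lemma errors_bounded:
  assumes "e \<in> errors"
  obtains C where "\<And>t. t \<ge> 0 \<Longrightarrow> - C \<le> e t \<and> e t \<le> C"
proof -
  have "e \<in> C0_half_line" using assms by (simp add: closed_loop_errors_def)
  then obtain C where C: "\<And>t. t \<ge> 0 \<Longrightarrow> \<bar>e t\<bar> \<le> C" using C0_half_line_bounded by blast
  show ?thesis by (rule that[of C]) (use C in \<open>auto simp: abs_le_iff minus_le_iff\<close>)
qed

text \<open>
  At \<open>T = 0\<close> the upper bound \<open>M\<close> drops out of the duality bound, which then concerns the undershoot
  alone.
\<close>
lemma OS_opt_value: "OS_opt errors = ereal (p1 / (z1 - p1))"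
proof (rule antisym)
  show "OS_opt errors \<le> ereal (p1 / (z1 - p1))"
  proof (rule ereal_le_epsilon2)
    fix \<epsilon> :: real assume \<epsilon>: "\<epsilon> > 0"
    have "\<forall>\<^sub>F T in at_right 0. undershoot T < p1 / (z1 - p1) + \<epsilon> / 2 \<and> T > 0"
      using order_tendstoD(2)[OF undershoot_limit, of "p1 / (z1 - p1) + \<epsilon> / 2"] \<epsilon>
      by (intro eventually_conj eventually_at_right_less) auto
    then obtain T where T: "undershoot T < p1 / (z1 - p1) + \<epsilon> / 2" "T > 0"
      using eventually_happens'[OF trivial_limit_at_right_real] by blast
    obtain e where e: "e \<in> errors" "\<forall>t\<ge>0. - undershoot T - \<epsilon> / 2 \<le> e t \<and> e t \<le> overshoot T + \<epsilon> / 2"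
      using near_bang_bang_error[OF T(2) half_gt_zero[OF \<epsilon>]] by blast
    have "max (- e t) 0 \<le> p1 / (z1 - p1) + \<epsilon>" if "t \<ge> 0" for t
      using e(2)[rule_format, OF that] T(1) undershoot_nonneg[OF T(2)] \<epsilon> by linarith
    thus "OS_opt errors \<le> ereal (p1 / (z1 - p1)) + ereal \<epsilon>"
      unfolding OS_opt_def by (intro INF_lower2[OF e(1)] SUP_least) auto
  qed
  show "ereal (p1 / (z1 - p1)) \<le> OS_opt errors"
    unfolding OS_opt_def
  proof (rule INF_greatest, rule ereal_le_real)
    fix e m assume e: "e \<in> errors" and "(SUP t\<in>{0..}. ereal (max (- e t) 0)) \<le> ereal m"
    hence "max (- e t) 0 \<le> m" if "t \<ge> 0" for t using that by (simp add: SUP_le_iff)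
    hence m: "- m \<le> e t" if "t \<ge> 0" for t using that by (simp add: minus_le_iff)
    obtain C where C: "\<And>t. t \<ge> 0 \<Longrightarrow> - C \<le> e t \<and> e t \<le> C" using errors_bounded[OF e] by blast
    have "1 / z1 \<le> - m / z1 + m / p1"
      using bang_bang_bound[OF e, of m C 0] m C by simp
    hence "p1 \<le> m * (z1 - p1)" using p1_pos z1_pos by (simp add: field_simps)
    thus "ereal (p1 / (z1 - p1)) \<le> ereal m" using p1_less_z1 by (simp add: pos_divide_le_eq)
  qed
qed

lemma POS_opt_value: "POS_opt errors = ereal 1"
proof (rule antisym)
  show "POS_opt errors \<le> ereal 1"
  proof (rule ereal_le_epsilon2)
    fix \<epsilon> :: real assume \<epsilon>: "\<epsilon> > 0"
    have "\<forall>\<^sub>F T in at_top. overshoot T < 1 + \<epsilon> / 2 \<and> T > 0"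
      using order_tendstoD(2)[OF overshoot_limit, of "1 + \<epsilon> / 2"] \<epsilon>
      by (intro eventually_conj eventually_gt_at_top) auto
    then obtain T where T: "overshoot T < 1 + \<epsilon> / 2" "T > 0"
      using eventually_happens'[OF trivial_limit_at_top_linorder] by blast
    obtain e where e: "e \<in> errors" "\<forall>t\<ge>0. - undershoot T - \<epsilon> / 2 \<le> e t \<and> e t \<le> overshoot T + \<epsilon> / 2"
      using near_bang_bang_error[OF T(2) half_gt_zero[OF \<epsilon>]] by blast
    have "max (e t) 0 \<le> 1 + \<epsilon>" if "t \<ge> 0" for t
      using e(2)[rule_format, OF that] T(1) \<epsilon> by linarith
    thus "POS_opt errors \<le> ereal 1 + ereal \<epsilon>"
      unfolding POS_opt_def by (intro INF_lower2[OF e(1)] SUP_least) auto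
  qed
  show "ereal 1 \<le> POS_opt errors"
    unfolding POS_opt_def
  proof (rule INF_greatest, rule ereal_le_real)
    fix e M assume e: "e \<in> errors" and "(SUP t\<in>{0..}. ereal (max (e t) 0)) \<le> ereal M"
    hence "e t \<le> M" if "t \<ge> 0" for t using that by (auto simp: SUP_le_iff)
    with error_sup_ge_1[OF e] show "ereal 1 \<le> ereal M" by simp
  qed
qed

text \<open>
  The switching time \<open>ln 2 / p1\<close> is the one at which overshoot and undershoot agree.
\<close>
lemma MA_opt_value: "MA_opt errors = ereal (1 / (1 - 2 powr (1 - z1 / p1)))"
proof -
  define T where "T = ln 2 / p1"
  define \<beta> where "\<beta> = (2::real) powr (1 - z1 / p1)"
  have T: "T > 0" using p1_pos by (simp add: T_def)
  have ep: "exp (- (p1 * T)) = 1 / 2" using p1_pos by (simp add: T_def exp_minus)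
  have ed: "exp (- ((z1 - p1) * T)) = \<beta>"
    using p1_pos by (simp add: T_def \<beta>_def powr_def field_simps)
  have "exp (- (z1 * T)) = exp (- (p1 * T)) * exp (- ((z1 - p1) * T))"
    by (simp add: exp_add[symmetric] algebra_simps)
  hence ez: "exp (- (z1 * T)) = \<beta> / 2" by (simp add: ep ed)
  have "\<beta> < 1" using ed[symmetric] T p1_less_z1 by simp
  have val: "undershoot T = 1 / (1 - \<beta>)" "overshoot T = 1 / (1 - \<beta>)"
    unfolding undershoot_def overshoot_def ep ez using \<open>\<beta> < 1\<close>
    by (simp_all add: field_simps)
  have "MA_opt errors = ereal (1 / (1 - \<beta>))"
  proof (rule antisym)
    show "MA_opt errors \<le> ereal (1 / (1 - \<beta>))"
    proof (rule ereal_le_epsilon2)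
      fix \<epsilon> :: real assume \<epsilon>: "\<epsilon> > 0"
      obtain e where e: "e \<in> errors"
          "\<forall>t\<ge>0. - (1 / (1 - \<beta>)) - \<epsilon> \<le> e t \<and> e t \<le> 1 / (1 - \<beta>) + \<epsilon>"
        using near_bang_bang_error[OF T \<epsilon>] unfolding val by blast
      have "\<bar>e t\<bar> \<le> 1 / (1 - \<beta>) + \<epsilon>" if "t \<ge> 0" for t
        using e(2)[rule_format, OF that] by linarith
      thus "MA_opt errors \<le> ereal (1 / (1 - \<beta>)) + ereal \<epsilon>"
        unfolding MA_opt_def by (intro INF_lower2[OF e(1)] SUP_least) auto
    qed
    show "ereal (1 / (1 - \<beta>)) \<le> MA_opt errors"
      unfolding MA_opt_def
    proof (rule INF_greatest, rule ereal_le_real)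
      fix e M assume e: "e \<in> errors" and "(SUP t\<in>{0..}. ereal \<bar>e t\<bar>) \<le> ereal M"
      hence "\<bar>e t\<bar> \<le> M" if "t \<ge> 0" for t using that by (auto simp: SUP_le_iff)
      hence "- M \<le> e t \<and> e t \<le> M" if "t \<ge> 0" for t using that by (simp add: abs_le_iff minus_le_iff)
      from bang_bang_bound[OF e this, of T] T
      have "1 / z1 \<le> (M - (M + M) * (\<beta> / 2)) / z1 - \<beta> * ((M - (M + M) * (1 / 2)) / p1)"
        unfolding ep ez ed by simp
      hence "1 / z1 \<le> M * (1 - \<beta>) / z1" by (simp add: algebra_simps)
      hence "1 \<le> M * (1 - \<beta>)" using z1_pos by (simp add: divide_le_cancel)
      thus "ereal (1 / (1 - \<beta>)) \<le> ereal M" using \<open>\<beta> < 1\<close> by (simp add: pos_divide_le_eq)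
    qed
  qed
  thus ?thesis by (simp add: \<beta>_def)
qed

text \<open>
  The switching time makes \<open>exp (-p1 T) - exp (-z1 T)\<close>, the reciprocal of the sum of the two
  levels, as large as possible.
\<close>
lemma FL_opt_value:
  defines "T \<equiv> ln (z1 / p1) / (z1 - p1)"
  shows "FL_opt errors = ereal (z1 / (z1 - p1) * exp (p1 * T) / 2)"
proof -
  have T: "T > 0" using p1_pos p1_less_z1 by (simp add: T_def)
  have ed: "exp (- ((z1 - p1) * T)) = p1 / z1"
    using p1_pos z1_pos p1_less_z1 by (simp add: T_def exp_minus)
  define Y where "Y = exp (- (p1 * T))"
  have Y: "Y > 0" "exp (p1 * T) = 1 / Y" by (simp_all add: Y_def exp_minus field_simps)
  have "exp (- (z1 * T)) = exp (- (p1 * T)) * exp (- ((z1 - p1) * T))"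
    by (simp add: exp_add[symmetric] algebra_simps)
  hence ez: "exp (- (z1 * T)) = Y * p1 / z1" by (simp add: ed Y_def)
  define R where "R = z1 / ((z1 - p1) * Y)"
  have "undershoot T + overshoot T = 1 / (Y - Y * p1 / z1)"
    by (simp add: undershoot_def overshoot_def ez Y_def[symmetric] add_divide_distrib[symmetric])
  also have "Y - Y * p1 / z1 = (z1 - p1) * Y / z1" using z1_pos by (simp add: field_simps)
  finally have R: "undershoot T + overshoot T = R" by (simp add: R_def)
  have "FL_opt errors = ereal (R / 2)"
  proof (rule antisym)
    show "FL_opt errors \<le> ereal (R / 2)"
    proof (rule ereal_le_epsilon2)
      fix \<epsilon> :: real assume \<epsilon>: "\<epsilon> > 0"
      obtain e where e: "e \<in> errors"
          "\<forall>t\<ge>0. - undershoot T - \<epsilon> \<le> e t \<and> e t \<le> overshoot T + \<epsilon>"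
        using near_bang_bang_error[OF T \<epsilon>] by blast
      have "(SUP t\<in>{0..}. ereal (e t)) - (INF t\<in>{0..}. ereal (e t))
          \<le> ereal (overshoot T + \<epsilon>) - ereal (- undershoot T - \<epsilon>)"
        using e by (intro ereal_minus_mono SUP_least INF_greatest) auto
      also have "\<dots> = ereal (R + 2 * \<epsilon>)" using R by simp
      finally have "ereal (1 / 2) * ((SUP t\<in>{0..}. ereal (e t)) - (INF t\<in>{0..}. ereal (e t)))
          \<le> ereal (1 / 2) * ereal (R + 2 * \<epsilon>)"
        by (rule ereal_mult_left_mono) simp
      also have "\<dots> = ereal (R / 2 + \<epsilon>)" by (simp add: add_divide_distrib)
      finally show "FL_opt errors \<le> ereal (R / 2) + ereal \<epsilon>"
        unfolding FL_opt_def by (intro INF_lower2[OF e(1)]) simp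
    qed
    show "ereal (R / 2) \<le> FL_opt errors"
      unfolding FL_opt_def
    proof (rule INF_greatest)
      fix e assume e: "e \<in> errors"
      let ?S = "SUP t\<in>{0..}. ereal (e t)" and ?I = "INF t\<in>{0..}. ereal (e t)"
      obtain C where C: "\<And>t. t \<ge> 0 \<Longrightarrow> - C \<le> e t \<and> e t \<le> C" using errors_bounded[OF e] by blast
      have "ereal (- C) \<le> ereal (e 0)" using C[of 0] by simp
      also have "\<dots> \<le> ?S" by (rule SUP_upper) simp
      finally have "\<bar>?S\<bar> \<noteq> \<infinity>" using SUP_least[of "{0..}" "\<lambda>t. ereal (e t)" "ereal C"] C
        by (auto simp: ereal_infty_less_eq)
      then obtain M where M: "?S = ereal M" by auto
      have "?I \<le> ereal (e 0)" by (rule INF_lower) simp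
      also have "\<dots> \<le> ereal C" using C[of 0] by simp
      finally have "\<bar>?I\<bar> \<noteq> \<infinity>" using INF_greatest[of "{0..}" "ereal (- C)" "\<lambda>t. ereal (e t)"] C
        by (auto simp: ereal_infty_less_eq)
      then obtain l where l: "?I = ereal l" by auto
      have "l \<le> e t \<and> e t \<le> M" if "t \<ge> 0" for t
        using SUP_upper[of t "{0..}" "\<lambda>t. ereal (e t)"] INF_lower[of t "{0..}" "\<lambda>t. ereal (e t)"] that
        by (simp add: M l)
      with bang_bang_bound[OF e, of "- l" M T] T
      have "1 / z1 \<le> (M - (M - l) * (Y * p1 / z1)) / z1 - p1 / z1 * ((M - (M - l) * Y) / p1)"
        by (simp add: ez ed Y_def[symmetric])
      also have "\<dots> = (M - l) * ((z1 - p1) * Y / z1) / z1"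
        using z1_pos p1_pos by (simp add: field_simps)
      finally have "1 \<le> (M - l) * ((z1 - p1) * Y / z1)"
        using z1_pos unfolding divide_le_cancel by blast
      hence "R \<le> M - l" using z1_pos p1_less_z1 Y(1) by (simp add: R_def field_simps)
      thus "ereal (R / 2) \<le> ereal (1 / 2) * (?S - ?I)" by (simp add: M l)
    qed
  qed
  thus ?thesis by (simp add: R_def Y(2))
qed

end

theorem proposition4p6:
  fixes z1 p1 h :: real and P n d x v :: ratfun
    and w :: "real \<Rightarrow> real" and F :: "(real \<Rightarrow> real) set"
  assumes "p1 > 0" and "z1 > p1"
    and "P = Fract [:- z1, 1:] [:- p1, 1:]"
    and "n \<in> stable_rat" and "d \<in> stable_rat" and "P = n / d"
    and "x \<in> stable_rat" and "v \<in> stable_rat" and "x * n + v * d = 1"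
    and "\<And>t. t \<ge> 0 \<Longrightarrow> w t = 1"
    and "h = p1 / (z1 - p1)"
    and "F = closed_loop_errors w n d v"
  shows "OS_opt F = ereal h
       \<and> MA_opt F = ereal (1 / (1 - 2 powr (- 1 / h)))
       \<and> FL_opt F = ereal ((h + 1) powr (h + 1) / (2 * h powr h))
       \<and> POS_opt F = ereal 1"
proof -
  interpret one_zero_one_pole_plant z1 p1 n d x v w
    using assms by unfold_locales auto
  have h: "h > 0" using assms(1,2,11) by simp
  have h1: "h + 1 = z1 / (z1 - p1)" using assms(2,11) by (simp add: field_simps)
  have exponent: "- 1 / h = 1 - z1 / p1"
    unfolding assms(11) using assms(1,2) by (simp add: field_simps)
  have fluctuation: "z1 / (z1 - p1) * exp (p1 * (ln (z1 / p1) / (z1 - p1))) / 2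
      = (h + 1) powr (h + 1) / (2 * h powr h)"
  proof -
    have ratio: "z1 / p1 = (h + 1) / h" unfolding h1 unfolding assms(11) using assms(2) by simp
    have "p1 * (ln (z1 / p1) / (z1 - p1)) = h * ln ((h + 1) / h)"
      unfolding ratio by (simp add: assms(11))
    hence "exp (p1 * (ln (z1 / p1) / (z1 - p1))) = ((h + 1) / h) powr h"
      using h by (simp add: powr_def)
    also have "\<dots> = (h + 1) powr h / h powr h" using h by (simp add: powr_divide)
    finally show ?thesis using h by (simp add: h1[symmetric] powr_add mult.commute)
  qed
  have "OS_opt errors = ereal h" by (simp only: OS_opt_value assms(11))
  moreover have "MA_opt errors = ereal (1 / (1 - 2 powr (- 1 / h)))"
    by (simp only: MA_opt_value exponent)
  moreover have "FL_opt errors = ereal ((h + 1) powr (h + 1) / (2 * h powr h))"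
    by (simp only: FL_opt_value fluctuation)
  ultimately show ?thesis unfolding assms(12) using POS_opt_value by blast
qed

end
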